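(* Let $E_1,E_2,E_k$ be event sets with $E_1\cap E_2\subseteq E_k$, let $E=E_1\cup E_2\cup E_k$, and let $E_u\subseteq E$. Let $L_i\subseteq E_i^*$, $i=1,2,k$, be prefix-closed languages, let $L=L_1\|L_2\|L_k$, and let $K\subseteq L$ be a prefix-closed language that is conditionally decomposable with respect to $(E_{1+k},E_{2+k},E_k)$. Assume that, for $i=1,2$, the natural projection $P^{i+k}_k$ is a $(P^{i+k}_i)^{-1}(L_i)$-observer and is OCC for $(P^{i+k}_i)^{-1}(L_i)$. If, in addition, $L_k\subseteq P_k(L)$ and $P_{i+k}$ is OCC for the language $P_{i+k}^{-1}(L_i\|L_k)$, for $i=1,2$, then $$\sup\mathrm{cC}\big(K,L,(E_{1+k,u},E_{2+k,u},E_{k,u})\big)=\sup\mathrm{C}(K,L,E_u).$$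
   Context: Notation. Event sets are finite alphabets. $E_{i+k}=E_i\cup E_k$; $E_{k,u}=E_u\cap E_k$; $E_{i+k,u}=E_u\cap E_{i+k}$. For $A\subseteq B$, the natural projection $B^*\to A^*$ is the monoid morphism erasing the symbols of $B\setminus A$ and fixing those of $A$. $P_k:E^*\to E_k^*$, $P_{i+k}:E^*\to E_{i+k}^*$, $P^{i+k}_k:E_{i+k}^*\to E_k^*$, $P^{i+k}_i:E_{i+k}^*\to E_i^*$ are natural projections. For languages $M_j\subseteq A_j^*$ the synchronous product is $\|_j M_j=\bigcap_j Q_j^{-1}(M_j)\subseteq(\bigcup_j A_j)^*$, with $Q_j:(\bigcup_l A_l)^*\to A_j^*$ the natural projection. $\overline M$ is the set of all prefixes of words of $M$; $M$ is prefix-closed if $M=\overline M$. Controllability. For a prefix-closed language $N$ over an event set $A$ and $A_u\subseteq A$, a language $M\subseteq A^*$ is controllable with respect to $N$ and $A_u$ if $\overline M A_u\cap N\subseteq\overline M$. $\sup\mathrm{C}(M,N,A_u)$ denotes the supremal controllable sublanguage of $M$ with respect to $N$ and $A_u$, i.e. the union of all sublanguages of $M$ that are controllable with respect to $N$ and $A_u$. Conditional decomposability: $K=P_{1+k}(K)\|P_{2+k}(K)\|P_k(K)$. Conditional controllability. A prefix-closed language $M\subseteq L$ is conditionally controllable with respect to $L=L_1\|L_2\|L_k$ and $(E_{1+k,u},E_{2+k,u},E_{k,u})$ if (i) $P_k(M)E_{k,u}\cap L_k\subseteq P_k(M)$; (ii.a) $P_{1+k}(M)E_{1+k,u}\cap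 \big(L_1\|P_k(M)\|P_k^{2+k}(L_2\|P_k(M))\big)\subseteq P_{1+k}(M)$; (ii.b) $P_{2+k}(M)E_{2+k,u}\cap \big(L_2\|P_k(M)\|P_k^{1+k}(L_1\|P_k(M))\big)\subseteq P_{2+k}(M)$. $\sup\mathrm{cC}(K,L,(E_{1+k,u},E_{2+k,u},E_{k,u}))$ denotes the supremal conditionally controllable sublanguage of $K$, i.e. the union of all conditionally controllable (prefix-closed) sublanguages of $K$. Observer. A natural projection $P:A^*\to B^*$, $B\subseteq A$, is an $N$-observer for $N\subseteq A^*$ if for all $t\in P(N)$ and $s\in\overline N$ such that $P(s)$ is a prefix of $t$, there exists $u\in A^*$ with $su\in N$ and $P(su)=t$. OCC. A natural projection $P:A^*\to B^*$, $B\subseteq A$, is output control consistent (OCC) for $N\subseteq A^*$ if for every $s\in\overline N$ of the form $s=\sigma_1\sigma_2\cdots\sigma_\ell$ or $s=s'\sigma_0\sigma_1\cdots\sigma_\ell$, $\ell\ge1$, where $\sigma_0,\sigma_\ell\in B$ and $\sigma_i\in A\setminus B$ for $i=1,\dots,\ell-1$: if $\sigma_\ell\in E_u$, then $\sigma_i\in E_u$ for all $i=1,\dots,\ell-1$. *)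

theory Defs
  imports Main "HOL-Library.Sublist"
begin

type_synonym 'e lang = "'e list set"

definition prefix_closure :: "'e lang \<Rightarrow> 'e lang" where
  "prefix_closure M = {v. \<exists>w\<in>M. prefix v w}"

definition prefix_closed :: "'e lang \<Rightarrow> bool" where
  "prefix_closed M \<longleftrightarrow> M = prefix_closure M"

text \<open>The value of a natural projection \<open>A\<^sup>* \<rightarrow> B\<^sup>*\<close> (with \<open>B \<subseteq> A\<close>) on a word does not depend
  on \<open>A\<close>, so only \<open>B\<close> is a parameter. The domain does matter for inverse images: it is the
  first argument of \<open>proj_inv\<close>.\<close>

definition proj :: "'e set \<Rightarrow> 'e list \<Rightarrow> 'e list" where
  "proj B w = filter (\<lambda>e. e \<in> B) w"

definition proj_inv :: "'e set \<Rightarrow> 'e set \<Rightarrow> 'e lang \<Rightarrow> 'e lang" where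
  "proj_inv A B M = {w \<in> lists A. proj B w \<in> M}"

text \<open>Each factor of a synchronous product is given together with its alphabet.\<close>

definition sync :: "('e set \<times> 'e lang) list \<Rightarrow> 'e lang" where
  "sync Ms = (let A = (\<Union>(B, M)\<in>set Ms. B) in (\<Inter>(B, M)\<in>set Ms. proj_inv A B M))"

definition append_events :: "'e lang \<Rightarrow> 'e set \<Rightarrow> 'e lang" where
  "append_events M A = {w @ [e] | w e. w \<in> M \<and> e \<in> A}"

definition controllable :: "'e lang \<Rightarrow> 'e lang \<Rightarrow> 'e set \<Rightarrow> bool" where
  "controllable M N Au \<longleftrightarrow>
     append_events (prefix_closure M) Au \<inter> N \<subseteq> prefix_closure M"

definition supC :: "'e lang \<Rightarrow> 'e lang \<Rightarrow> 'e set \<Rightarrow> 'e lang" where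
  "supC M N Au = \<Union>{M'. M' \<subseteq> M \<and> controllable M' N Au}"

definition cond_decomposable :: "'e set \<Rightarrow> 'e set \<Rightarrow> 'e set \<Rightarrow> 'e lang \<Rightarrow> bool" where
  "cond_decomposable E1 E2 Ek K \<longleftrightarrow>
     K = sync [(E1 \<union> Ek, proj (E1 \<union> Ek) ` K), (E2 \<union> Ek, proj (E2 \<union> Ek) ` K), (Ek, proj Ek ` K)]"

text \<open>The plant is passed as its three components with their alphabets; \<open>E1ku\<close>, \<open>E2ku\<close> and
  \<open>Eku\<close> are the uncontrollable events in \<open>E1 \<union> Ek\<close>, \<open>E2 \<union> Ek\<close> and \<open>Ek\<close>.\<close>

definition cond_controllable ::
  "'e lang \<Rightarrow> ('e set \<times> 'e lang) \<times> ('e set \<times> 'e lang) \<times> ('e set \<times> 'e lang)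
    \<Rightarrow> 'e set \<times> 'e set \<times> 'e set \<Rightarrow> bool" where
  "cond_controllable M = (\<lambda>((E1, L1), (E2, L2), (Ek, Lk)) (E1ku, E2ku, Eku).
     prefix_closed M \<and>
     M \<subseteq> sync [(E1, L1), (E2, L2), (Ek, Lk)] \<and>
     append_events (proj Ek ` M) Eku \<inter> Lk \<subseteq> proj Ek ` M \<and>
     append_events (proj (E1 \<union> Ek) ` M) E1ku
       \<inter> sync [(E1, L1), (Ek, proj Ek ` M), (Ek, proj Ek ` sync [(E2, L2), (Ek, proj Ek ` M)])]
       \<subseteq> proj (E1 \<union> Ek) ` M \<and>
     append_events (proj (E2 \<union> Ek) ` M) E2ku
       \<inter> sync [(E2, L2), (Ek, proj Ek ` M), (Ek, proj Ek ` sync [(E1, L1), (Ek, proj Ek ` M)])]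
       \<subseteq> proj (E2 \<union> Ek) ` M)"

definition supcC ::
  "'e lang \<Rightarrow> ('e set \<times> 'e lang) \<times> ('e set \<times> 'e lang) \<times> ('e set \<times> 'e lang)
    \<Rightarrow> 'e set \<times> 'e set \<times> 'e set \<Rightarrow> 'e lang" where
  "supcC K Ls Eus = \<Union>{M. M \<subseteq> K \<and> cond_controllable M Ls Eus}"

text \<open>In the next two definitions the projection is \<open>A\<^sup>* \<rightarrow> B\<^sup>*\<close>, with \<open>B \<subseteq> A\<close>, and \<open>N \<subseteq> A\<^sup>*\<close>.\<close>

definition observer :: "'e set \<Rightarrow> 'e set \<Rightarrow> 'e lang \<Rightarrow> bool" where
  "observer A B N \<longleftrightarrow>
     (\<forall>t\<in>proj B ` N. \<forall>s\<in>prefix_closure N. prefix (proj B s) t \<longrightarrow>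
        (\<exists>u\<in>lists A. s @ u \<in> N \<and> proj B (s @ u) = t))"

text \<open>Below, \<open>v\<close> is \<open>\<sigma>\<^sub>1 \<dots> \<sigma>\<^sub>l\<^sub>-\<^sub>1\<close> (possibly empty), \<open>b\<close> is \<open>\<sigma>\<^sub>0\<close> and \<open>c\<close> is \<open>\<sigma>\<^sub>l\<close>.\<close>

definition OCC :: "'e set \<Rightarrow> 'e set \<Rightarrow> 'e set \<Rightarrow> 'e lang \<Rightarrow> bool" where
  "OCC Eu A B N \<longleftrightarrow>
     (\<forall>s\<in>prefix_closure N. \<forall>v\<in>lists (A - B). \<forall>c\<in>B.
        s = v @ [c] \<or> (\<exists>s'. \<exists>b\<in>B. s = s' @ [b] @ v @ [c]) \<longrightarrow>
        c \<in> Eu \<longrightarrow> set v \<subseteq> Eu)"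

end

theory Submission imports Defs begin

text \<open>A conditionally controllable sublanguage \<open>M\<close> of \<open>K\<close> is contained in the synchronous product
  of its three projections, which is always controllable and stays inside the conditionally
  decomposable \<open>K\<close>. Conversely, let \<open>M\<close> be prefix-closed and controllable, \<open>s \<in> M\<close>, and let
  \<open>u\<close> be an uncontrollable coordinator event that a local plant \<open>L\<^sub>i\<close> can perform after the
  projection of \<open>s\<close>. The observer property provides local events \<open>w\<close> enabling \<open>u\<close> in \<open>L\<^sub>i\<close>
  after \<open>s\<close>, and output control consistency makes them uncontrollable. Since the local alphabets
  meet only inside \<open>E\<^sub>k\<close>, such words \<open>w\<close> for \<open>i = 1, 2\<close> do not interfere with each other, so
  controllability keeps the extended word in \<open>M\<close>, and \<open>M\<close> is conditionally controllable.\<close>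

section \<open>Natural projections, prefix closures and synchronous products\<close>

lemma proj_append [simp]: "proj A (x @ y) = proj A x @ proj A y"
  by (simp add: proj_def)

lemma proj_proj [simp]: "proj A (proj B w) = proj (A \<inter> B) w"
  by (auto simp: proj_def intro: filter_cong)

lemma proj_Cons [simp]: "proj A (e # w) = (if e \<in> A then e # proj A w else proj A w)"
  by (simp add: proj_def)

lemma proj_Nil [simp]: "proj A [] = []"
  by (simp add: proj_def)

lemma set_proj [simp]: "set (proj A w) = set w \<inter> A"
  by (auto simp: proj_def)

lemma proj_eq_Nil: "set w \<inter> A = {} \<Longrightarrow> proj A w = []"
  by (auto simp: proj_def filter_empty_conv)

lemma prefix_closure_superset: "M \<subseteq> prefix_closure M"
  by (auto simp: prefix_closure_def)

lemma prefix_closed_iff: "prefix_closed M \<longleftrightarrow> (\<forall>x y. x @ y \<in> M \<longrightarrow> x \<in> M)"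
proof -
  have "prefix_closed M \<longleftrightarrow> prefix_closure M \<subseteq> M"
    using prefix_closure_superset[of M] by (auto simp: prefix_closed_def)
  also have "\<dots> \<longleftrightarrow> (\<forall>x y. x @ y \<in> M \<longrightarrow> x \<in> M)"
    by (auto simp: prefix_closure_def prefix_def)
  finally show ?thesis .
qed

lemma prefix_closedD: "prefix_closed M \<Longrightarrow> x @ y \<in> M \<Longrightarrow> x \<in> M"
  by (auto simp: prefix_closed_iff)

lemma prefix_closed_prefix_closure: "prefix_closed (prefix_closure M)"
  by (auto simp: prefix_closed_iff prefix_closure_def dest: append_prefixD)

lemma prefix_closure_mono: "M \<subseteq> N \<Longrightarrow> prefix_closure M \<subseteq> prefix_closure N"
  by (auto simp: prefix_closure_def)

lemma prefix_closure_id: "prefix_closed M \<Longrightarrow> prefix_closure M = M"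
  by (simp add: prefix_closed_def)

text \<open>Cuts of a projected word lift to cuts of the word itself; this is why projections
  preserve prefix-closedness.\<close>

lemma proj_eq_append:
  "proj A w = x @ y \<Longrightarrow> \<exists>w1 w2. w = w1 @ w2 \<and> proj A w1 = x"
proof (induction w arbitrary: x)
  case (Cons e w)
  show ?case
  \<comment> \<open>Only a kept event with nothing left of \<open>x\<close> forces the cut before
    \<open>e\<close>; in every other case, \<open>e\<close> erased included, \<open>e\<close> goes
    into \<open>w1\<close>.\<close>
  proof (cases "e \<in> A \<and> x = []")
    case True
    then show ?thesis by (intro exI[of _ "[]"] exI[of _ "e # w"]) simp
  next
    case False
    then obtain x' where x': "x = (if e \<in> A then e # x' else x')" "proj A w = x' @ y"
      using Cons.prems by (auto simp: Cons_eq_append_conv split: if_splits)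
    with Cons.IH obtain w1 w2 where "w = w1 @ w2" "proj A w1 = x'"
      by blast
    with x' show ?thesis by (intro exI[of _ "e # w1"] exI[of _ w2]) simp
  qed
qed simp

lemma prefix_closed_proj_image: "prefix_closed M \<Longrightarrow> prefix_closed (proj A ` M)"
  unfolding prefix_closed_iff by (blast dest: proj_eq_append[OF sym])

lemma prefix_closed_proj_inv: "prefix_closed M \<Longrightarrow> prefix_closed (proj_inv A B M)"
  by (auto simp: prefix_closed_iff proj_inv_def)

lemma sync2_iff:
  "w \<in> sync [(A, M), (B, N)] \<longleftrightarrow> set w \<subseteq> A \<union> B \<and> proj A w \<in> M \<and> proj B w \<in> N"
  by (auto simp: sync_def proj_inv_def Let_def)

lemma sync3_iff:
  "w \<in> sync [(A, M), (B, N), (C, R)] \<longleftrightarrow>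
     set w \<subseteq> A \<union> B \<union> C \<and> proj A w \<in> M \<and> proj B w \<in> N \<and> proj C w \<in> R"
  by (auto simp: sync_def proj_inv_def Let_def)

lemma prefix_closed_sync3:
  "prefix_closed M \<Longrightarrow> prefix_closed N \<Longrightarrow> prefix_closed R
     \<Longrightarrow> prefix_closed (sync [(A, M), (B, N), (C, R)])"
  by (auto simp: prefix_closed_iff sync3_iff)

section \<open>Extensions by uncontrollable events\<close>

lemma controllable_step:
  assumes "controllable M N Au" "prefix_closed M" "s \<in> M" "e \<in> Au" "s @ [e] \<in> N"
  shows "s @ [e] \<in> M"
  using assms by (auto simp: controllable_def append_events_def prefix_closure_id)

lemma controllable_extend:
  assumes "controllable M N Au" "prefix_closed M" "prefix_closed N" "s \<in> M"
  shows "set v \<subseteq> Au \<Longrightarrow> s @ v \<in> N \<Longrightarrow> s @ v \<in> M"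
\<comment> \<open>Controllability adds one event at the right end; prefix-closedness of
  \<open>N\<close> keeps the intermediate words in \<open>N\<close>.\<close>
proof (induction v rule: rev_induct)
  case Nil
  then show ?case using assms by simp
next
  case (snoc e v)
  then have "s @ v \<in> M"
    using prefix_closedD[OF assms(3), of "s @ v" "[e]"] by simp
  then show ?case
    using snoc.prems controllable_step[OF assms(1,2), of "s @ v" e] by simp
qed

text \<open>The observer property gives a continuation of \<open>x\<close> whose only event in
  \<open>B\<close> is \<open>u\<close>. Cutting it right after \<open>u\<close> leaves a block
  \<open>w\<close> of erased events, which OCC makes uncontrollable because \<open>u\<close>
  is.\<close>

lemma observer_OCC_extension:
  assumes obs: "observer A B N" and occ: "OCC Eu A B N" and pc: "prefix_closed N"
    and sub: "N \<subseteq> lists A" and x: "x \<in> N" and xu: "proj B x @ [u] \<in> proj B ` N"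
    and u: "u \<in> B" "u \<in> Eu"
  obtains w where "set w \<subseteq> Eu \<inter> (A - B)" and "x @ w @ [u] \<in> N"
proof -
  have "\<exists>v\<in>lists A. x @ v \<in> N \<and> proj B (x @ v) = proj B x @ [u]"
    using obs x xu unfolding observer_def prefix_closure_id[OF pc] by (meson prefixI)
  then obtain v where v: "v \<in> lists A" "x @ v \<in> N" "filter (\<lambda>e. e \<in> B) v = [u]"
    by (auto simp: proj_def)
  then obtain w z where w: "v = w @ u # z" "\<forall>e\<in>set w. e \<notin> B"
    by (auto simp: filter_eq_Cons_iff)
  have N: "x @ w @ [u] \<in> N"
    using v(2) w(1) prefix_closedD[OF pc, of "x @ w @ [u]" z] by simp
  have wA: "set w \<subseteq> A - B"
    using v(1) w by auto
  have occ': "set y \<subseteq> Eu"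
    if "y \<in> lists (A - B)"
      "x @ w @ [u] = y @ [u] \<or> (\<exists>s'. \<exists>b\<in>B. x @ w @ [u] = s' @ [b] @ y @ [u])" for y
    using occ N that u unfolding OCC_def prefix_closure_id[OF pc] by meson
  have xA: "set x \<subseteq> A"
    using x sub by auto
  have "set w \<subseteq> Eu"
  \<comment> \<open>The maximal erased block before \<open>u\<close> may begin inside
    \<open>x\<close>: it is \<open>x @ w\<close> if \<open>x\<close> has no event of
    \<open>B\<close>, and otherwise \<open>y @ w\<close> with \<open>y\<close> the part of
    \<open>x\<close> after its last such event. OCC applied to the whole block covers
    \<open>w\<close>.\<close>
  proof (cases "\<exists>b\<in>set x. b \<in> B")
    case False
    then show ?thesis using occ'[of "x @ w"] wA xA by auto
  next
    case True
    then obtain s' b y where y: "x = s' @ b # y" "b \<in> B" "\<forall>e\<in>set y. e \<notin> B"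
      using split_list_last_prop[of x "\<lambda>b. b \<in> B"] by auto
    then show ?thesis using occ'[of "y @ w"] wA xA by auto
  qed
  with wA N that show thesis by auto
qed

text \<open>Transfers the previous extension to global words: \<open>s\<close> and \<open>y\<close>
  enter only through their projections to \<open>Ei \<union> Ek\<close>, and \<open>y\<close>
  witnesses that \<open>Li\<close> admits the coordinator word ending in \<open>u\<close>.\<close>

lemma local_extension:
  assumes obs: "observer (Ei \<union> Ek) Ek (proj_inv (Ei \<union> Ek) Ei Li)"
    and occ: "OCC Eu (Ei \<union> Ek) Ek (proj_inv (Ei \<union> Ek) Ei Li)"
    and pc: "prefix_closed Li"
    and s: "proj Ei s \<in> Li"
    and y: "proj Ei y \<in> Li" "proj Ek y = proj Ek s @ [u]"
    and u: "u \<in> Eu \<inter> Ek"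
  obtains w where "set w \<subseteq> Eu \<inter> (Ei - Ek)" and "proj Ei (s @ w @ [u]) \<in> Li"
proof -
  let ?N = "proj_inv (Ei \<union> Ek) Ei Li"
  have abs: "Ei \<inter> (Ei \<union> Ek) = Ei" "Ek \<inter> (Ei \<union> Ek) = Ek"
    by auto
  have sN: "proj (Ei \<union> Ek) s \<in> ?N"
    using s by (auto simp: proj_inv_def abs)
  have "proj (Ei \<union> Ek) y \<in> ?N"
    using y by (auto simp: proj_inv_def abs)
  then have "proj Ek (proj (Ei \<union> Ek) s) @ [u] \<in> proj Ek ` ?N"
    using y(2) by (metis abs(2) imageI proj_proj)
  moreover have "?N \<subseteq> lists (Ei \<union> Ek)"
    by (auto simp: proj_inv_def)
  ultimately obtain w where w: "set w \<subseteq> Eu \<inter> (Ei \<union> Ek - Ek)"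
      "proj (Ei \<union> Ek) s @ w @ [u] \<in> ?N"
    using observer_OCC_extension[OF obs occ prefix_closed_proj_inv[OF pc] _ sN] u by blast
  show thesis
  proof (rule that[of w])
    show "set w \<subseteq> Eu \<inter> (Ei - Ek)"
      using w(1) by auto
    show "proj Ei (s @ w @ [u]) \<in> Li"
      using w(2) by (simp add: proj_inv_def abs split: if_splits)
  qed
qed

section \<open>From controllability to conditional controllability\<close>

lemma coordinator_controllable:
  assumes E12: "E1 \<inter> E2 \<subseteq> Ek"
    and pc: "prefix_closed L1" "prefix_closed L2" "prefix_closed Lk"
    and L: "L = sync [(E1, L1), (E2, L2), (Ek, Lk)]"
    and obs: "observer (E1 \<union> Ek) Ek (proj_inv (E1 \<union> Ek) E1 L1)"
      "observer (E2 \<union> Ek) Ek (proj_inv (E2 \<union> Ek) E2 L2)"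
    and occ: "OCC Eu (E1 \<union> Ek) Ek (proj_inv (E1 \<union> Ek) E1 L1)"
      "OCC Eu (E2 \<union> Ek) Ek (proj_inv (E2 \<union> Ek) E2 L2)"
    and Lk: "Lk \<subseteq> proj Ek ` L"
    and M: "controllable M L Eu" "prefix_closed M" "M \<subseteq> L"
  shows "append_events (proj Ek ` M) (Eu \<inter> Ek) \<inter> Lk \<subseteq> proj Ek ` M"
proof
  fix t assume "t \<in> append_events (proj Ek ` M) (Eu \<inter> Ek) \<inter> Lk"
  then obtain s u where s: "s \<in> M" and u: "u \<in> Eu \<inter> Ek" and t: "t = proj Ek s @ [u]" "t \<in> Lk"
    by (auto simp: append_events_def)
  \<comment> \<open>A single global word \<open>y\<close> serves both local plants, since its
    projections lie in \<open>L1\<close> and \<open>L2\<close>.\<close>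
  from Lk t obtain y where y: "y \<in> L" "proj Ek y = proj Ek s @ [u]"
    by (metis imageE subsetD)
  have sL: "s \<in> L"
    using s M by auto
  obtain w1 where w1: "set w1 \<subseteq> Eu \<inter> (E1 - Ek)" "proj E1 (s @ w1 @ [u]) \<in> L1"
    by (rule local_extension[OF obs(1) occ(1) pc(1) _ _ y(2) u])
      (use sL y(1) in \<open>simp_all add: L sync3_iff\<close>)
  obtain w2 where w2: "set w2 \<subseteq> Eu \<inter> (E2 - Ek)" "proj E2 (s @ w2 @ [u]) \<in> L2"
    by (rule local_extension[OF obs(2) occ(2) pc(2) _ _ y(2) u])
      (use sL y(1) in \<open>simp_all add: L sync3_iff\<close>)
  have nil: "proj E1 w2 = []" "proj E2 w1 = []" "proj Ek w1 = []" "proj Ek w2 = []"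
    using w1 w2 E12 by (auto intro!: proj_eq_Nil)
  \<comment> \<open>Neither plant sees the other's block, and the coordinator sees neither, so each
    component can be checked alone.\<close>
  have "s @ w1 @ w2 @ [u] \<in> L"
    using w1 w2 sL u t by (auto simp: L sync3_iff nil)
  then have "s @ w1 @ w2 @ [u] \<in> M"
    using controllable_extend[OF M(1,2) prefix_closed_sync3[OF pc, of E1 E2 Ek, folded L] s,
        of "w1 @ w2 @ [u]"] w1 w2 u by auto
  moreover have "t = proj Ek (s @ w1 @ w2 @ [u])"
    using u t by (simp add: nil)
  ultimately show "t \<in> proj Ek ` M"
    by blast
qed

text \<open>Here \<open>a\<close> already describes what \<open>L1\<close> does, so only the other
  plant may need local events before \<open>u\<close>. The last factor of the product guarantees
  that it can follow.\<close>

lemma local_controllable: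
  assumes E12: "E1 \<inter> E2 \<subseteq> Ek"
    and pc: "prefix_closed L1" "prefix_closed L2" "prefix_closed Lk"
    and L: "L = sync [(E1, L1), (E2, L2), (Ek, Lk)]"
    and obs: "observer (E2 \<union> Ek) Ek (proj_inv (E2 \<union> Ek) E2 L2)"
    and occ: "OCC Eu (E2 \<union> Ek) Ek (proj_inv (E2 \<union> Ek) E2 L2)"
    and M: "controllable M L Eu" "prefix_closed M" "M \<subseteq> L"
  shows "append_events (proj (E1 \<union> Ek) ` M) (Eu \<inter> (E1 \<union> Ek))
      \<inter> sync [(E1, L1), (Ek, proj Ek ` M), (Ek, proj Ek ` sync [(E2, L2), (Ek, proj Ek ` M)])]
      \<subseteq> proj (E1 \<union> Ek) ` M"
proof
  have abs: "E1 \<inter> (E1 \<union> Ek) = E1" "Ek \<inter> (E1 \<union> Ek) = Ek"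
    by auto
  fix a
  assume "a \<in> append_events (proj (E1 \<union> Ek) ` M) (Eu \<inter> (E1 \<union> Ek))
      \<inter> sync [(E1, L1), (Ek, proj Ek ` M), (Ek, proj Ek ` sync [(E2, L2), (Ek, proj Ek ` M)])]"
  then have "a \<in> append_events (proj (E1 \<union> Ek) ` M) (Eu \<inter> (E1 \<union> Ek))"
    and a1: "proj E1 a \<in> L1"
    and ak: "proj Ek a \<in> proj Ek ` M" "proj Ek a \<in> proj Ek ` sync [(E2, L2), (Ek, proj Ek ` M)]"
    by (simp_all only: Int_iff sync3_iff)
  then obtain s u where s: "s \<in> M" and u: "u \<in> Eu" "u \<in> E1 \<union> Ek"
    and a: "a = proj (E1 \<union> Ek) s @ [u]"
    unfolding append_events_def by blast
  have pa: "proj E1 (s @ [u]) \<in> L1" "proj Ek (s @ [u]) = proj Ek a"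
    using a a1 by (auto simp: abs)
  have sL: "s \<in> L"
    using s M by auto
  have "proj Ek ` M \<subseteq> Lk"
    using M(3) by (auto simp: L sync3_iff)
  with ak have akL: "proj Ek a \<in> Lk"
    by auto
  obtain w where w: "set w \<subseteq> Eu \<inter> (E2 - Ek)" "proj E2 (s @ w @ [u]) \<in> L2"
  \<comment> \<open>A shared \<open>u\<close> needs the block from the observer; a \<open>u\<close>
    outside \<open>Ek\<close> belongs to \<open>E1\<close> alone, is invisible to \<open>L2\<close>,
    and the empty block suffices.\<close>
  proof (cases "u \<in> Ek")
    case True
    from ak(2) obtain y where y: "proj E2 y \<in> L2" "proj Ek y = proj Ek s @ [u]"
      using True pa(2) by (auto simp: sync2_iff)
    show thesis
      by (rule local_extension[OF obs occ pc(2) _ y, OF _ _ that])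
        (use sL u True in \<open>simp_all add: L sync3_iff\<close>)
  next
    case False
    then have "u \<notin> E2"
      using u E12 by auto
    then show thesis
      using that[of "[]"] sL by (simp add: L sync3_iff)
  qed
  have nil: "proj E1 w = []" "proj Ek w = []" "proj (E1 \<union> Ek) w = []"
    using w E12 by (auto intro!: proj_eq_Nil)
  have "set (s @ w @ [u]) \<subseteq> E1 \<union> E2 \<union> Ek"
    using w(1) sL u by (auto simp: L sync3_iff)
  moreover have "proj E1 (s @ w @ [u]) \<in> L1" "proj Ek (s @ w @ [u]) \<in> Lk"
    using pa akL by (simp_all add: nil)
  ultimately have "s @ w @ [u] \<in> L"
    using w(2) by (simp only: L sync3_iff)
  then have "s @ w @ [u] \<in> M"
    using controllable_extend[OF M(1,2) prefix_closed_sync3[OF pc, of E1 E2 Ek, folded L] s,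
        of "w @ [u]"] w u by auto
  moreover have "a = proj (E1 \<union> Ek) (s @ w @ [u])"
    using u a by (simp add: nil)
  ultimately show "a \<in> proj (E1 \<union> Ek) ` M"
    by blast
qed

text \<open>The three conditions treat the projections separately, so the words of \<open>M\<close>
  witnessing them for \<open>s @ [u]\<close> may differ. Passing to the product \<open>M'\<close>
  removes the need for a common witness.\<close>

lemma cond_controllable_imp_controllable:
  assumes M: "cond_controllable M ((E1, L1), (E2, L2), (Ek, Lk))
      (Eu \<inter> (E1 \<union> Ek), Eu \<inter> (E2 \<union> Ek), Eu \<inter> Ek)"
  defines "M' \<equiv> sync [(E1 \<union> Ek, proj (E1 \<union> Ek) ` M), (E2 \<union> Ek, proj (E2 \<union> Ek) ` M), (Ek, proj Ek ` M)]"
  shows "controllable M' (sync [(E1, L1), (E2, L2), (Ek, Lk)]) Eu"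
proof -
  let ?S1 = "sync [(E1, L1), (Ek, proj Ek ` M)]" and ?S2 = "sync [(E2, L2), (Ek, proj Ek ` M)]"
  have pcM: "prefix_closed M"
    and ck: "append_events (proj Ek ` M) (Eu \<inter> Ek) \<inter> Lk \<subseteq> proj Ek ` M"
    and c1: "append_events (proj (E1 \<union> Ek) ` M) (Eu \<inter> (E1 \<union> Ek))
        \<inter> sync [(E1, L1), (Ek, proj Ek ` M), (Ek, proj Ek ` ?S2)] \<subseteq> proj (E1 \<union> Ek) ` M"
    and c2: "append_events (proj (E2 \<union> Ek) ` M) (Eu \<inter> (E2 \<union> Ek))
        \<inter> sync [(E2, L2), (Ek, proj Ek ` M), (Ek, proj Ek ` ?S1)] \<subseteq> proj (E2 \<union> Ek) ` M"
    using M by (auto simp: cond_controllable_def)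
  have pcM': "prefix_closure M' = M'"
    using pcM by (simp add: M'_def prefix_closure_id prefix_closed_sync3 prefix_closed_proj_image)
  have abs: "E1 \<inter> (E1 \<union> Ek) = E1" "Ek \<inter> (E1 \<union> Ek) = Ek" "E2 \<inter> (E2 \<union> Ek) = E2" "Ek \<inter> (E2 \<union> Ek) = Ek"
    by auto
  have "s @ [u] \<in> M'" if s: "s \<in> M'" and u: "u \<in> Eu" and su: "s @ [u] \<in> sync [(E1, L1), (E2, L2), (Ek, Lk)]" for s u
  proof -
    let ?w = "s @ [u]"
    have sM: "proj (E1 \<union> Ek) s \<in> proj (E1 \<union> Ek) ` M" "proj (E2 \<union> Ek) s \<in> proj (E2 \<union> Ek) ` M"
      "proj Ek s \<in> proj Ek ` M"
      using s by (auto simp: M'_def sync3_iff)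
    have wL: "set ?w \<subseteq> E1 \<union> E2 \<union> Ek" "proj E1 ?w \<in> L1" "proj E2 ?w \<in> L2" "proj Ek ?w \<in> Lk"
      using su unfolding sync3_iff by blast+
    \<comment> \<open>The coordinator comes first: its result is a factor of the languages in both
      local conditions. An event outside an alphabet leaves that projection unchanged, here and
      below.\<close>
    have wk: "proj Ek ?w \<in> proj Ek ` M"
    proof (cases "u \<in> Ek")
      case True
      then have "proj Ek ?w \<in> append_events (proj Ek ` M) (Eu \<inter> Ek)"
        using sM(3) u by (auto simp: append_events_def)
      then show ?thesis using ck wL(4) by blast
    qed (use sM(3) in simp)
    \<comment> \<open>The projections of \<open>?w\<close> itself witness that each plant can follow
      the other.\<close>
    have "proj (E1 \<union> Ek) ?w \<in> ?S1"
      using wL wk unfolding sync2_iff proj_proj abs by auto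
    then have S1: "proj Ek ?w \<in> proj Ek ` ?S1"
      by (metis abs(2) imageI proj_proj)
    have "proj (E2 \<union> Ek) ?w \<in> ?S2"
      using wL wk unfolding sync2_iff proj_proj abs by auto
    then have S2: "proj Ek ?w \<in> proj Ek ` ?S2"
      by (metis abs(4) imageI proj_proj)
    have w1: "proj (E1 \<union> Ek) ?w \<in> proj (E1 \<union> Ek) ` M"
    proof (cases "u \<in> E1 \<union> Ek")
      case True
      then have "proj (E1 \<union> Ek) ?w \<in> append_events (proj (E1 \<union> Ek) ` M) (Eu \<inter> (E1 \<union> Ek))"
        using sM(1) u by (auto simp: append_events_def)
      moreover have "proj (E1 \<union> Ek) ?w \<in> sync [(E1, L1), (Ek, proj Ek ` M), (Ek, proj Ek ` ?S2)]"
        using wL(2) wk S2 unfolding sync3_iff proj_proj abs by auto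
      ultimately show ?thesis using c1 by blast
    qed (use sM(1) in simp)
    have w2: "proj (E2 \<union> Ek) ?w \<in> proj (E2 \<union> Ek) ` M"
    proof (cases "u \<in> E2 \<union> Ek")
      case True
      then have "proj (E2 \<union> Ek) ?w \<in> append_events (proj (E2 \<union> Ek) ` M) (Eu \<inter> (E2 \<union> Ek))"
        using sM(2) u by (auto simp: append_events_def)
      moreover have "proj (E2 \<union> Ek) ?w \<in> sync [(E2, L2), (Ek, proj Ek ` M), (Ek, proj Ek ` ?S1)]"
        using wL(3) wk S1 unfolding sync3_iff proj_proj abs by auto
      ultimately show ?thesis using c2 by blast
    qed (use sM(2) in simp)
    show ?thesis
      using wL(1) w1 w2 wk unfolding M'_def sync3_iff by blast
  qed
  then show ?thesis
    by (auto simp: controllable_def append_events_def pcM')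
qed

section \<open>Equality of the two supremal languages\<close>

theorem theorem27:
  fixes E1 E2 Ek E Eu :: "'e set"
    and L1 L2 Lk L K :: "'e lang"
  assumes "finite E1" and "finite E2" and "finite Ek"
    and "E1 \<inter> E2 \<subseteq> Ek"
    and "E = E1 \<union> E2 \<union> Ek"
    and "Eu \<subseteq> E"
    and "L1 \<subseteq> lists E1" and "prefix_closed L1"
    and "L2 \<subseteq> lists E2" and "prefix_closed L2"
    and "Lk \<subseteq> lists Ek" and "prefix_closed Lk"
    and "L = sync [(E1, L1), (E2, L2), (Ek, Lk)]"
    and "K \<subseteq> L" and "prefix_closed K"
    and "cond_decomposable E1 E2 Ek K"
    and "observer (E1 \<union> Ek) Ek (proj_inv (E1 \<union> Ek) E1 L1)"
    and "observer (E2 \<union> Ek) Ek (proj_inv (E2 \<union> Ek) E2 L2)"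
    and "OCC Eu (E1 \<union> Ek) Ek (proj_inv (E1 \<union> Ek) E1 L1)"
    and "OCC Eu (E2 \<union> Ek) Ek (proj_inv (E2 \<union> Ek) E2 L2)"
    and "Lk \<subseteq> proj Ek ` L"
    and "OCC Eu E (E1 \<union> Ek) (proj_inv E (E1 \<union> Ek) (sync [(E1, L1), (Ek, Lk)]))"
    and "OCC Eu E (E2 \<union> Ek) (proj_inv E (E2 \<union> Ek) (sync [(E2, L2), (Ek, Lk)]))"
  shows "supcC K ((E1, L1), (E2, L2), (Ek, Lk)) (Eu \<inter> (E1 \<union> Ek), Eu \<inter> (E2 \<union> Ek), Eu \<inter> Ek)
       = supC K L Eu"
proof (rule antisym)
  let ?Ls = "((E1, L1), (E2, L2), (Ek, Lk))"
  let ?Us = "(Eu \<inter> (E1 \<union> Ek), Eu \<inter> (E2 \<union> Ek), Eu \<inter> Ek)"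
  have E12: "E1 \<inter> E2 \<subseteq> Ek" and E21: "E2 \<inter> E1 \<subseteq> Ek"
    using assms(4) by auto
  \<comment> \<open>The swapped form \<open>L'\<close>, like \<open>E21\<close>, lets the local
    lemma be reused with indices 1 and 2 exchanged.\<close>
  have L: "L = sync [(E1, L1), (E2, L2), (Ek, Lk)]" and L': "L = sync [(E2, L2), (E1, L1), (Ek, Lk)]"
    using assms(13) by (auto simp: sync3_iff)
  show "supcC K ?Ls ?Us \<subseteq> supC K L Eu"
    unfolding supcC_def
  proof (rule Union_least, clarify)
    fix M w assume M: "M \<subseteq> K" "cond_controllable M ?Ls ?Us" and w: "w \<in> M"
    \<comment> \<open>\<open>?M'\<close> is the controllable sublanguage covering \<open>M\<close>;
      monotonicity and conditional decomposability keep it inside \<open>K\<close>.\<close>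
    let ?M' = "sync [(E1 \<union> Ek, proj (E1 \<union> Ek) ` M), (E2 \<union> Ek, proj (E2 \<union> Ek) ` M), (Ek, proj Ek ` M)]"
    have "?M' \<subseteq> sync [(E1 \<union> Ek, proj (E1 \<union> Ek) ` K), (E2 \<union> Ek, proj (E2 \<union> Ek) ` K), (Ek, proj Ek ` K)]"
    proof
      fix x assume "x \<in> ?M'"
      moreover have "proj A ` M \<subseteq> proj A ` K" for A
        using M(1) by (rule image_mono)
      ultimately show "x \<in> sync [(E1 \<union> Ek, proj (E1 \<union> Ek) ` K), (E2 \<union> Ek, proj (E2 \<union> Ek) ` K), (Ek, proj Ek ` K)]"
        unfolding sync3_iff by (meson subsetD)
    qed
    also have "\<dots> = K"
      using assms(16) by (simp add: cond_decomposable_def)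
    finally have "?M' \<subseteq> K" .
    moreover have "controllable ?M' L Eu"
      using cond_controllable_imp_controllable[OF M(2)] by (simp add: L)
    moreover have "w \<in> L"
      using w M(1) assms(14) by blast
    then have "w \<in> ?M'"
      using w by (auto simp: sync3_iff L)
    ultimately show "w \<in> supC K L Eu"
      by (auto simp: supC_def)
  qed
  show "supC K L Eu \<subseteq> supcC K ?Ls ?Us"
    unfolding supC_def
  proof (rule Union_least, clarify)
    fix M0 w assume M0: "M0 \<subseteq> K" "controllable M0 L Eu" and w: "w \<in> M0"
    \<comment> \<open>\<open>supC\<close> also ranges over languages that are not prefix-closed.
      Controllability depends only on the closure, and the closure stays in the prefix-closed
      \<open>K\<close>.\<close>
    let ?M = "prefix_closure M0"
    have pcM: "prefix_closed ?M"
      by (rule prefix_closed_prefix_closure)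
    have MsubK: "?M \<subseteq> K"
      using prefix_closure_mono[OF M0(1)] assms(15) by (simp add: prefix_closure_id)
    then have MsubL: "?M \<subseteq> L"
      using assms(14) by simp
    have cM: "controllable ?M L Eu"
      using M0(2) by (simp add: controllable_def prefix_closure_id[OF pcM])
    note coordinator_controllable[OF E12 assms(8,10,12) L assms(17,18,19,20,21) cM pcM MsubL]
    moreover note local_controllable[OF E12 assms(8,10,12) L assms(18,20) cM pcM MsubL]
    moreover note local_controllable[OF E21 assms(10,8,12) L' assms(17,19) cM pcM MsubL]
    ultimately have "cond_controllable ?M ?Ls ?Us"
      using pcM MsubL by (simp add: cond_controllable_def L)
    moreover have "w \<in> ?M"
      using w prefix_closure_superset by blast
    ultimately show "w \<in> supcC K ?Ls ?Us"
      using MsubK by (auto simp: supcC_def)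
  qed
qed

end
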